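(* Let $m$ and $n$ be nonnegative integers with the same parity, and let $l$ be a nonnegative integer. Let $A$ and $B$ be $m \times m$ and $n \times n$ skew-symmetric matrices, and let $S$ and $T$ be $m \times l$ and $n \times l$ matrices. Then $$ \sum_K \operatorname{Pf} \begin{pmatrix} A & S([m];K) \\ -{}^t S([m];K) & O \end{pmatrix} \operatorname{Pf} \begin{pmatrix} B & T([n];K) \\ -{}^t T([n];K) & O \end{pmatrix} = (-1)^{ \binom{n}{2} } \operatorname{Pf} \begin{pmatrix} A & S\, {}^t T \\ - T\, {}^t S & -B \end{pmatrix}, $$ where $K$ runs over all subsets of $[l]$ with $\# K \equiv m \equiv n \bmod 2$.
   Context: All matrices have entries in a fixed commutative ring; skew-symmetric means ${}^tX=-X$ with zero diagonal, where ${}^tX$ is the transpose. For a skew-symmetric matrix $X=(x_{ij})_{1\le i,j\le 2r}$ of even order, the Pfaffian is $$\operatorname{Pf}(X)=\sum_{\sigma\in F_{2r}}\operatorname{sgn}(\sigma)\prod_{i=1}^r x_{\sigma(2i-1),\sigma(2i)},$$ where $F_{2r}$ is the set of permutations $\sigma\in S_{2r}$ with $\sigma(1)<\sigma(3)<\dots<\sigma(2r-1)$ and $\sigma(2i-1)<\sigma(2i)$ for $1\le i\le r$. The Pfaffian of the empty ($0\times 0$) matrix is $1$. We write $[n]=\{1,2,\dots,n\}$. For an $M\times N$ matrix $X$ and subsets $I\subset[M]$, $J\subset[N]$, $X(I;J)$ denotes the submatrix of $X$ with rows indexed by $I$ and columns indexed by $J$ (in increasing order). $O$ denotes a zero matrix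 of the appropriate size, and $\#K$ is the cardinality of $K$. *)

theory Defs
  imports "Jordan_Normal_Form.Determinant" "Jordan_Normal_Form.DL_Submatrix"
begin

text \<open>
  Rows, columns and permutations are indexed from 0, as in
  \<^theory>\<open>Jordan_Normal_Form.Matrix\<close>: the index set \<open>[n] = {1, ..., n}\<close> is rendered as \<open>{0..<n}\<close>.
\<close>

definition skew_symmetric_mat :: "'a :: comm_ring_1 mat \<Rightarrow> bool" where
  "skew_symmetric_mat X \<longleftrightarrow>
     square_mat X \<and> transpose_mat X = - X \<and> (\<forall>i < dim_row X. X $$ (i, i) = 0)"

text \<open>
  The set \<open>F\<^sub>2\<^sub>r\<close>. After the index shift, the odd positions \<open>2i - 1\<close> (for \<open>1 \<le> i \<le> r\<close>)
  become \<open>2 * i\<close> and the even positions \<open>2i\<close> become \<open>2 * i + 1\<close> (for \<open>i < r\<close>).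
\<close>

definition matching_perms :: "nat \<Rightarrow> (nat \<Rightarrow> nat) set" where
  "matching_perms r =
     {\<sigma>. \<sigma> permutes {0..<2 * r} \<and>
          (\<forall>i j. i < j \<and> j < r \<longrightarrow> \<sigma> (2 * i) < \<sigma> (2 * j)) \<and>
          (\<forall>i < r. \<sigma> (2 * i) < \<sigma> (2 * i + 1))}"

text \<open>Only meaningful for skew-symmetric matrices of even order.\<close>

definition pfaffian :: "'a :: comm_ring_1 mat \<Rightarrow> 'a" where
  "pfaffian X =
     (let r = dim_row X div 2
      in \<Sum>\<sigma> \<in> matching_perms r. signof \<sigma> * (\<Prod>i<r. X $$ (\<sigma> (2 * i), \<sigma> (2 * i + 1))))"

lemma pfaffian_empty: "dim_row X = 0 \<Longrightarrow> pfaffian X = 1"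
  by (simp add: pfaffian_def matching_perms_def)

end

theory Submission
  imports Defs
begin

text \<open>
  Generalise from matrices to Pfaffians of lists of indices with respect to a weight, so that both
  sides make sense (and vanish) for odd orders. Then induct on the number of rows of \<open>A\<close>, expanding
  along its first row. The terms with an entry of \<open>A\<close> match by induction. A term with an entry
  \<open>S(1, k)\<close> comes with the second Pfaffian for some \<open>K\<close> containing \<open>k\<close>; expanding that one along
  the row \<open>k\<close> yields an entry \<open>T(j, k)\<close> times a product of Pfaffians for \<open>K - {k}\<close>. Here \<open>K - {k}\<close>
  may be replaced by an arbitrary subset, since the expansions for subsets that contain \<open>k\<close> are those of
  a Pfaffian with a repeated row. Summation over \<open>k\<close> produces the entries of \<open>S T\<^sup>t\<close>.
\<close>

section \<open>Contraction of functions on lists\<close>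

text \<open>
  The interior product by the linear form \<open>\<phi>\<close>, i.e. the signed sum over all ways of deleting one
  entry. The recursive form makes its anticommutativity, and thus the alternation of Pfaffians, an
  easy induction.
\<close>

primrec contract :: "('i \<Rightarrow> 'a :: comm_ring_1) \<Rightarrow> ('i list \<Rightarrow> 'a) \<Rightarrow> 'i list \<Rightarrow> 'a" where
  "contract \<phi> f [] = 0"
| "contract \<phi> f (y # ys) = \<phi> y * f ys - contract \<phi> (\<lambda>zs. f (y # zs)) ys"

text \<open>As a congruence rule it records that a contraction evaluates its function only on lists
  one entry shorter. The termination of \<open>pf\<close>, which passes itself unapplied to
  \<open>contract\<close>, rests on that.\<close>

lemma contract_cong [fundef_cong]:
  assumes "xs = ys"
    and "\<And>x. x \<in> set ys \<Longrightarrow> \<phi> x = \<psi> x"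
    and "\<And>zs. Suc (length zs) = length ys \<Longrightarrow> set zs \<subseteq> set ys \<Longrightarrow> f zs = g zs"
  shows "contract \<phi> f xs = contract \<psi> g ys"
  using assms(2,3) unfolding assms(1)
proof (induction ys arbitrary: f g)
  case Nil
  then show ?case by simp
next
  case (Cons y ys)
  have "contract \<phi> (\<lambda>zs. f (y # zs)) ys = contract \<psi> (\<lambda>zs. g (y # zs)) ys"
    by (rule Cons.IH) (auto intro!: Cons.prems)
  moreover have "f ys = g ys" by (rule Cons.prems(2)) auto
  ultimately show ?case using Cons.prems(1) by simp
qed

text \<open>The closed form reduces the linearity rules to rules about finite sums.\<close>

lemma contract_conv_sum:
  "contract \<phi> f xs =
     (\<Sum>i<length xs. (- 1) ^ i * \<phi> (xs ! i) * f (take i xs @ drop (Suc i) xs))"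
  by (induction xs arbitrary: f)
     (simp_all add: sum.lessThan_Suc_shift sum_negf del: sum.lessThan_Suc)

lemma contract_zero_left: "contract (\<lambda>_. 0) f xs = 0"
  by (simp add: contract_conv_sum)

lemma contract_zero_right: "contract \<phi> (\<lambda>_. 0) xs = 0"
  by (simp add: contract_conv_sum)

lemma contract_uminus_left: "contract (\<lambda>x. - \<phi> x) f xs = - contract \<phi> f xs"
  by (simp add: contract_conv_sum sum_negf)

lemma contract_scale_left: "contract (\<lambda>x. c * \<phi> x) f xs = c * contract \<phi> f xs"
  by (simp add: contract_conv_sum sum_distrib_left mult_ac)

lemma contract_scale_right: "contract \<phi> (\<lambda>xs. c * f xs) xs = c * contract \<phi> f xs"
  by (simp add: contract_conv_sum sum_distrib_left mult_ac)

lemma contract_uminus_right: "contract \<phi> (\<lambda>xs. - f xs) xs = - contract \<phi> f xs"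
  using contract_scale_right[of \<phi> "- 1" f xs] by simp

lemma contract_diff_right:
  "contract \<phi> (\<lambda>xs. f xs - g xs) xs = contract \<phi> f xs - contract \<phi> g xs"
  by (simp add: contract_conv_sum right_diff_distrib sum_subtractf)

lemma contract_sum_left:
  "contract (\<lambda>x. \<Sum>k\<in>L. \<phi> k x) f xs = (\<Sum>k\<in>L. contract (\<phi> k) f xs)"
  unfolding contract_conv_sum
  by (subst sum.swap) (simp add: sum_distrib_left sum_distrib_right)

lemma contract_sum_right:
  "contract \<phi> (\<lambda>xs. \<Sum>k\<in>L. f k xs) xs = (\<Sum>k\<in>L. contract \<phi> (f k) xs)"
  unfolding contract_conv_sum
  by (subst sum.swap) (simp add: sum_distrib_left sum_distrib_right)

lemma contract_append:
  "contract \<phi> f (xs @ ys) = contract \<phi> (\<lambda>zs. f (zs @ ys)) xs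
     + (- 1) ^ length xs * contract \<phi> (\<lambda>zs. f (xs @ zs)) ys"
  by (induction xs arbitrary: f) simp_all

lemma contract_map:
  "contract \<phi> f (map h xs) = contract (\<lambda>x. \<phi> (h x)) (\<lambda>zs. f (map h zs)) xs"
  by (induction xs arbitrary: f) simp_all

text \<open>For a list \<open>y # ys\<close>, unfolding leaves \<open>\<phi> y * contract \<psi> f
  ys - \<psi> y * contract \<phi> f ys\<close>, which is antisymmetric in \<open>\<phi>\<close> and
  \<open>\<psi>\<close>, plus a double contraction over \<open>ys\<close>.\<close>

lemma contract_anticommute:
  "contract \<phi> (contract \<psi> f) xs = - contract \<psi> (contract \<phi> f) xs"
  by (induction xs arbitrary: f) (simp_all add: contract_diff_right contract_scale_right)

text \<open>Anticommutativity only shows that twice this value is 0, and 2 may be a zero divisor;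
  hence a separate induction.\<close>

lemma contract_contract: "contract \<phi> (contract \<phi> f) xs = 0"
  by (induction xs arbitrary: f) (simp_all add: contract_diff_right contract_scale_right)

text \<open>Deleting \<open>x\<close> or \<open>y\<close> gives the same two terms on both sides
  with opposite signs. Any other deletion keeps \<open>x\<close> and \<open>y\<close> adjacent
  behind a prefix no longer than \<open>xs\<close>; this bound allows induction on the length of the
  prefix.\<close>

lemma contract_swap:
  assumes "\<And>us vs. length us \<le> length xs \<Longrightarrow> f (us @ x # y # vs) = - f (us @ y # x # vs)"
  shows "contract \<phi> f (xs @ x # y # ys) = - contract \<phi> f (xs @ y # x # ys)"
  using assms
proof (induction xs arbitrary: f)
  case Nil
  have "f (x # y # vs) = - f (y # x # vs)" for vs
    using Nil[of "[]"] by simp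
  then show ?case by (simp add: contract_uminus_right)
next
  case (Cons u us)
  have "contract \<phi> (\<lambda>zs. f (u # zs)) (us @ x # y # ys)
      = - contract \<phi> (\<lambda>zs. f (u # zs)) (us @ y # x # ys)"
    by (rule Cons.IH) (use Cons.prems[of "u # _"] in simp)
  with Cons.prems[of us] show ?case by simp
qed

text \<open>Deleting either copy leaves the same list, with opposite signs.\<close>

lemma contract_repeat:
  assumes "\<And>us vs. length us \<le> length xs \<Longrightarrow> f (us @ x # x # vs) = 0"
  shows "contract \<phi> f (xs @ x # x # ys) = 0"
  using assms
proof (induction xs arbitrary: f)
  case Nil
  have "f (x # x # vs) = 0" for vs
    using Nil[of "[]"] by simp
  then show ?case by (simp add: contract_zero_right)
next
  case (Cons u us)
  have "contract \<phi> (\<lambda>zs. f (u # zs)) (us @ x # x # ys) = 0"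
    by (rule Cons.IH) (use Cons.prems[of "u # _"] in simp)
  with Cons.prems[of us] show ?case by simp
qed

section \<open>Pfaffians of lists\<close>

text \<open>This is the expansion along the first row. It reads only weights of an earlier entry
  against a later one, that is, the part above the diagonal.\<close>

fun pf :: "('i \<Rightarrow> 'i \<Rightarrow> 'a :: comm_ring_1) \<Rightarrow> 'i list \<Rightarrow> 'a" where
  "pf w [] = 1"
| "pf w (x # xs) = contract (w x) (pf w) xs"

lemma pf_cong:
  assumes "\<And>x y. x \<in> set xs \<Longrightarrow> y \<in> set xs \<Longrightarrow> v x y = w x y"
  shows "pf v xs = pf w xs"
  using assms
proof (induction xs rule: length_induct)
  case (1 xs)
  show ?case
  proof (cases xs)
    case (Cons y ys)
    have "contract (v y) (pf v) ys = contract (w y) (pf w) ys"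
    proof (rule contract_cong)
      show "pf v zs = pf w zs" if "Suc (length zs) = length ys" "set zs \<subseteq> set ys" for zs
        using 1 that Cons by (simp add: subset_iff)
    qed (use 1 Cons in auto)
    with Cons show ?thesis by simp
  qed simp
qed

lemma pf_map: "pf w (map h xs) = pf (\<lambda>x y. w (h x) (h y)) xs"
proof (induction xs rule: length_induct)
  case (1 xs)
  show ?case
  proof (cases xs)
    case (Cons y ys)
    have "contract (w (h y)) (pf w) (map h ys) =
        contract (\<lambda>x. w (h y) (h x)) (pf (\<lambda>x y. w (h x) (h y))) ys"
      unfolding contract_map by (rule contract_cong) (use 1 Cons in auto)
    with Cons show ?thesis by simp
  qed simp
qed

text \<open>Each expansion removes two entries, so an odd list ends in a single entry, whose
  contraction is empty.\<close>

lemma pf_odd: "odd (length xs) \<Longrightarrow> pf w xs = 0"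
proof (induction xs rule: length_induct)
  case (1 xs)
  show ?case
  proof (cases xs)
    case (Cons y ys)
    have "contract (w y) (pf w) ys = contract (w y) (\<lambda>_. 0) ys"
    proof (rule contract_cong)
      show "pf w zs = 0" if "Suc (length zs) = length ys" for zs
      proof -
        from that 1(2) Cons have "odd (length zs)" by (metis even_Suc length_Cons)
        with 1(1) that Cons show ?thesis by simp
      qed
    qed auto
    with Cons show ?thesis by (simp add: contract_zero_right)
  qed (use 1 in simp)
qed

lemma choose_two_Suc: "Suc n choose 2 = (n choose 2) + n"
  by (simp add: numeral_2_eq_2)

text \<open>For even length the exponent has the parity of the number of matched pairs; for odd
  length both sides vanish. The binomial form is the one in which the sign of the identity is
  stated.\<close>

lemma pf_uminus: "pf (\<lambda>x y. - w x y) xs = (- 1) ^ (length xs choose 2) * pf w xs"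
proof (induction xs rule: length_induct)
  case (1 xs)
  show ?case
  proof (cases xs)
    case (Cons y ys)
    have "contract (\<lambda>x. - w y x) (pf (\<lambda>x y. - w x y)) ys
        = contract (\<lambda>x. - w y x) (\<lambda>zs. (- 1) ^ ((length ys - 1) choose 2) * pf w zs) ys"
    proof (rule contract_cong)
      show "pf (\<lambda>x y. - w x y) zs = (- 1) ^ ((length ys - 1) choose 2) * pf w zs"
        if "Suc (length zs) = length ys" for zs
        using 1 Cons that[symmetric] by simp
    qed auto
    also have "\<dots> = - ((- 1) ^ ((length ys - 1) choose 2) * pf w xs)"
      using Cons by (simp add: contract_uminus_left contract_scale_right)
    \<comment> \<open>For \<open>ys = z # zs\<close> the two binomial coefficients differ by the odd
      number \<open>2 * length zs + 1\<close>; for empty \<open>ys\<close> the Pfaffian is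
      0.\<close>
    also have "\<dots> = (- 1) ^ (length xs choose 2) * pf w xs"
    proof (cases ys)
      case Nil
      then show ?thesis using Cons by simp
    next
      case (Cons z zs)
      then show ?thesis using \<open>xs = y # ys\<close>
        by (simp add: choose_two_Suc power_add mult.assoc)
    qed
    finally show ?thesis using Cons by simp
  qed (simp add: numeral_2_eq_2)
qed

section \<open>Alternation of Pfaffians\<close>

text \<open>\<open>diag\<close> is a separate assumption because \<open>skew\<close> only forces
  \<open>2 * w x x = 0\<close>.\<close>

locale alternating_weight =
  fixes w :: "'i \<Rightarrow> 'i \<Rightarrow> 'a :: comm_ring_1"
  assumes skew: "w y x = - w x y"
    and diag: "w x x = 0"
begin

text \<open>At the front, a swap negates the weight of the pair and exchanges two nested
  contractions, which anticommute. Further back, expansion along the first entry shortens the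
  prefix.\<close>

lemma pf_swap: "pf w (us @ x # y # vs) = - pf w (us @ y # x # vs)"
proof (induction us arbitrary: vs rule: length_induct)
  case (1 us)
  show ?case
  proof (cases us)
    case Nil
    have "contract (w x) (contract (w y) (pf w)) vs = - contract (w y) (contract (w x) (pf w)) vs"
      by (rule contract_anticommute)
    then show ?thesis using Nil skew[of x y] by simp
  next
    case (Cons u us')
    have "contract (w u) (pf w) (us' @ x # y # vs) = - contract (w u) (pf w) (us' @ y # x # vs)"
      by (rule contract_swap) (use 1 Cons in auto)
    with Cons show ?thesis by simp
  qed
qed

lemma pf_repeat_adjacent: "pf w (us @ x # x # vs) = 0"
proof (induction us arbitrary: vs rule: length_induct)
  case (1 us)
  show ?case
  proof (cases us)
    case Nil
    then show ?thesis by (simp add: diag contract_contract)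
  next
    case (Cons u us')
    have "contract (w u) (pf w) (us' @ x # x # vs) = 0"
      by (rule contract_repeat) (use 1 Cons in auto)
    with Cons show ?thesis by simp
  qed
qed

lemma pf_move: "pf w (us @ x # vs) = (- 1) ^ length us * pf w (x # us @ vs)"
proof (induction us arbitrary: vs rule: rev_induct)
  case Nil
  then show ?case by simp
next
  case (snoc u us)
  have "pf w ((us @ [u]) @ x # vs) = - pf w (us @ x # u # vs)"
    using pf_swap[of us u x vs] by simp
  then show ?case using snoc by (simp del: pf.simps)
qed

lemma pf_repeat:
  assumes "x \<in> set xs"
  shows "pf w (x # xs) = 0"
proof -
  obtain us vs where "xs = us @ x # vs"
    using assms by (auto dest: split_list)
  then show ?thesis
    using pf_move[of "x # us" x vs] pf_repeat_adjacent[of "[]" x "us @ vs"]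
    by (simp del: pf.simps)
qed

end

section \<open>Expanding a product over subsets\<close>

lemma remove1_nth:
  "distinct xs \<Longrightarrow> i < length xs \<Longrightarrow> remove1 (xs ! i) xs = take i xs @ drop (Suc i) xs"
  by (induction xs arbitrary: i) (auto simp: nth_Cons' gr0_conv_Suc split: nat.splits)

text \<open>The sign for deleting position \<open>i\<close> of \<open>ks\<close> cancels against the
  sign for moving \<open>h (ks ! i)\<close> past the \<open>i\<close> entries before it. Only the
  passage across \<open>vs\<close> leaves a sign, so the sum can run over a set.\<close>

lemma (in alternating_weight) contract_times_pf:
  assumes "distinct ks"
  shows "contract \<phi> f ks * pf w (vs @ map h ks) =
    (- 1) ^ length vs *
      (\<Sum>k\<in>set ks. \<phi> k * (f (remove1 k ks) * pf w (h k # vs @ map h (remove1 k ks))))"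
proof -
  define g where "g k = \<phi> k * (f (remove1 k ks) * pf w (h k # vs @ map h (remove1 k ks)))" for k
  have "(- 1) ^ i * \<phi> (ks ! i) * f (take i ks @ drop (Suc i) ks) * pf w (vs @ map h ks)
      = (- 1) ^ length vs * g (ks ! i)" if "i < length ks" for i
  proof -
    have "vs @ map h ks = (vs @ map h (take i ks)) @ h (ks ! i) # map h (drop (Suc i) ks)"
      using that by (metis append.assoc id_take_nth_drop list.simps(9) map_append)
    then have "pf w (vs @ map h ks) = (- 1) ^ (length vs + i) *
        pf w (h (ks ! i) # vs @ map h (take i ks @ drop (Suc i) ks))"
      using that by (simp only: pf_move) simp
    with assms that show ?thesis
      by (simp add: g_def remove1_nth power_add mult_ac del: pf.simps)
  qed
  then have "contract \<phi> f ks * pf w (vs @ map h ks)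
      = (- 1) ^ length vs * (\<Sum>i<length ks. g (ks ! i))"
    by (simp add: contract_conv_sum sum_distrib_right sum_distrib_left)
  also have "(\<Sum>i<length ks. g (ks ! i)) = sum g (set ks)"
    by (rule sum.reindex_bij_betw) (use assms in \<open>simp add: bij_betw_nth\<close>)
  finally show ?thesis by (simp add: g_def)
qed

text \<open>Removing \<open>k\<close> yields only subsets without \<open>k\<close>; the vanishing condition frees \<open>M\<close> from that.\<close>

lemma sum_Pow_remove:
  assumes "finite L" "\<And>k M. k \<in> M \<Longrightarrow> M \<subseteq> L \<Longrightarrow> h k M = 0"
  shows "(\<Sum>K\<in>Pow L. \<Sum>k\<in>K. h k (K - {k})) = (\<Sum>k\<in>L. \<Sum>M\<in>Pow L. h k M)"
proof -
  have "(\<Sum>K\<in>Pow L. \<Sum>k\<in>K. h k (K - {k})) = (\<Sum>(K, k)\<in>Sigma (Pow L) (\<lambda>K. K). h k (K - {k}))"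
    using assms(1) by (intro sum.Sigma) (auto dest: finite_subset)
  also have "\<dots> = (\<Sum>(k, M)\<in>Sigma L (\<lambda>k. Pow (L - {k})). h k M)"
    by (rule sum.reindex_bij_witness[of _ "\<lambda>(k, M). (insert k M, k)" "\<lambda>(K, k). (k, K - {k})"])
       auto
  also have "\<dots> = (\<Sum>k\<in>L. \<Sum>M\<in>Pow (L - {k}). h k M)"
    using assms(1) by (intro sum.Sigma[symmetric]) auto
  also have "\<dots> = (\<Sum>k\<in>L. \<Sum>M\<in>Pow L. h k M)"
    by (intro sum.cong refl sum.mono_neutral_left) (use assms in auto)
  finally show ?thesis .
qed

section \<open>Block Pfaffians\<close>

text \<open>Indices carry the label of their block instead of a position, so sublists need no
  renumbering. \<open>s\<close> also determines the lower left block, minus its transpose.\<close>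

fun block_weight ::
  "('p \<Rightarrow> 'p \<Rightarrow> 'a :: comm_ring_1) \<Rightarrow> ('p \<Rightarrow> 'k \<Rightarrow> 'a) \<Rightarrow> ('k \<Rightarrow> 'k \<Rightarrow> 'a)
    \<Rightarrow> 'p + 'k \<Rightarrow> 'p + 'k \<Rightarrow> 'a" where
  "block_weight a s d (Inl p) (Inl p') = a p p'"
| "block_weight a s d (Inl p) (Inr k) = s p k"
| "block_weight a s d (Inr k) (Inl p) = - s p k"
| "block_weight a s d (Inr k) (Inr k') = d k k'"

abbreviation block_pf ::
  "('p \<Rightarrow> 'p \<Rightarrow> 'a :: comm_ring_1) \<Rightarrow> ('p \<Rightarrow> 'k \<Rightarrow> 'a) \<Rightarrow> ('k \<Rightarrow> 'k \<Rightarrow> 'a)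
    \<Rightarrow> 'p list \<Rightarrow> 'k list \<Rightarrow> 'a" where
  "block_pf a s d ps ks \<equiv> pf (block_weight a s d) (map Inl ps @ map Inr ks)"

lemma block_pf_Cons:
  "block_pf a s d (p # ps) ks = contract (a p) (\<lambda>zs. block_pf a s d zs ks) ps
     + (- 1) ^ length ps * contract (s p) (\<lambda>zs. block_pf a s d ps zs) ks"
  by (simp add: contract_append contract_map)

text \<open>In the row of \<open>k\<close> the lower right block contributes zeros, and the lower
  left one the entries \<open>- s p k\<close>.\<close>

lemma pf_Inr_Cons:
  "pf (block_weight a s (\<lambda>_ _. 0)) (Inr k # map Inl ps @ map Inr ks) =
     - contract (\<lambda>p. s p k) (\<lambda>zs. block_pf a s (\<lambda>_ _. 0) zs ks) ps"
  by (simp add: contract_append contract_map contract_zero_left contract_uminus_left)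

lemma block_pf_Nil_left: "block_pf a s d [] ks = pf d ks"
  by (simp add: pf_map)

lemma block_pf_Nil_right: "block_pf a s d ps [] = pf a ps"
  by (simp add: pf_map)

lemma pf_zero: "pf (\<lambda>_ _. 0) ks = (if ks = [] then 1 else 0)"
  by (cases ks) (simp_all add: contract_zero_left)

lemma alternating_block_weight:
  assumes "alternating_weight a" "alternating_weight d"
  shows "alternating_weight (block_weight a s d)"
proof -
  interpret a: alternating_weight a by fact
  interpret d: alternating_weight d by fact
  show ?thesis
  proof
    fix x y
    show "block_weight a s d y x = - block_weight a s d x y"
      by (cases x; cases y) (simp_all add: a.skew[symmetric] d.skew[symmetric])
    show "block_weight a s d x x = 0"
      by (cases x) (simp_all add: a.diag d.diag)
  qed
qed

section \<open>The identity for lists\<close>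

context
  fixes L :: "'k :: linorder set" and b :: "'q \<Rightarrow> 'q \<Rightarrow> 'a :: comm_ring_1"
  assumes L: "finite L" and b: "alternating_weight b"
begin

text \<open>A contraction over \<open>K\<close> in one factor is traded for a contraction over
  \<open>qs\<close> in the other: the contracted \<open>k\<close> moves to the front of the second
  Pfaffian, which is then expanded along it. Summing over \<open>k\<close> forms the entries of a
  matrix product.\<close>

lemma sum_contract_block_pf:
  fixes t :: "'q \<Rightarrow> 'k \<Rightarrow> 'a"
  shows "(\<Sum>K\<in>Pow L. contract \<phi> f (sorted_list_of_set K)
        * block_pf b t (\<lambda>_ _. 0) qs (sorted_list_of_set K)) =
      - ((- 1) ^ length qs * contract (\<lambda>q. \<Sum>k\<in>L. \<phi> k * t q k)
          (\<lambda>zs. \<Sum>K\<in>Pow L. f (sorted_list_of_set K)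
             * block_pf b t (\<lambda>_ _. 0) zs (sorted_list_of_set K)) qs)"
proof -
  let ?w = "block_weight b t (\<lambda>_ _. 0)"
  interpret alternating_weight ?w
    by (rule alternating_block_weight[OF b]) (simp add: alternating_weight_def)
  define h where "h k M = \<phi> k * (f (sorted_list_of_set M)
      * pf ?w (Inr k # map Inl qs @ map Inr (sorted_list_of_set M)))" for k M
  have "contract \<phi> f (sorted_list_of_set K) * block_pf b t (\<lambda>_ _. 0) qs (sorted_list_of_set K)
      = (- 1) ^ length qs * (\<Sum>k\<in>K. h k (K - {k}))" if "K \<subseteq> L" for K
    using finite_subset[OF that L]
      contract_times_pf[OF distinct_sorted_list_of_set, of \<phi> f K "map Inl qs" Inr]
    by (simp add: h_def sorted_list_of_set_remove del: pf.simps)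
  then have "(\<Sum>K\<in>Pow L. contract \<phi> f (sorted_list_of_set K)
        * block_pf b t (\<lambda>_ _. 0) qs (sorted_list_of_set K))
      = (- 1) ^ length qs * (\<Sum>K\<in>Pow L. \<Sum>k\<in>K. h k (K - {k}))"
    by (simp add: sum_distrib_left)
  also have "(\<Sum>K\<in>Pow L. \<Sum>k\<in>K. h k (K - {k})) = (\<Sum>k\<in>L. \<Sum>M\<in>Pow L. h k M)"
  proof (rule sum_Pow_remove[OF L])
    show "h k M = 0" if "k \<in> M" "M \<subseteq> L" for k M
    proof -
      \<comment> \<open>For \<open>k\<close> in \<open>M\<close> the Pfaffian in
        \<open>h k M\<close> has the row of \<open>k\<close> twice.\<close>
      have "(Inr k :: 'q + 'k) \<in> set (map Inl qs @ map Inr (sorted_list_of_set M))"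
        using that finite_subset[OF that(2) L] by simp
      then show ?thesis unfolding h_def by (subst pf_repeat) auto
    qed
  qed
  also have "\<dots> = - contract (\<lambda>q. \<Sum>k\<in>L. \<phi> k * t q k)
      (\<lambda>zs. \<Sum>K\<in>Pow L. f (sorted_list_of_set K)
         * block_pf b t (\<lambda>_ _. 0) zs (sorted_list_of_set K)) qs"
    unfolding h_def pf_Inr_Cons
    by (simp add: contract_sum_left contract_sum_right contract_scale_left
        contract_scale_right sum_negf sum_distrib_left)
  finally show ?thesis by simp
qed

lemma sum_block_pf:
  fixes t :: "'q \<Rightarrow> 'k \<Rightarrow> 'a" and s :: "'p \<Rightarrow> 'k \<Rightarrow> 'a"
  shows "(\<Sum>K\<in>Pow L. block_pf a s (\<lambda>_ _. 0) ps (sorted_list_of_set K)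
        * block_pf b t (\<lambda>_ _. 0) qs (sorted_list_of_set K)) =
      (- 1) ^ (length qs choose 2)
        * block_pf a (\<lambda>p q. \<Sum>k\<in>L. s p k * t q k) (\<lambda>x y. - b x y) ps qs"
proof (induction ps arbitrary: qs rule: length_induct)
  case (1 ps)
  let ?P = "\<lambda>ps K. block_pf a s (\<lambda>_ _. 0) ps (sorted_list_of_set K)"
  let ?Q = "\<lambda>qs K. block_pf b t (\<lambda>_ _. 0) qs (sorted_list_of_set K)"
  let ?c = "\<lambda>p q. \<Sum>k\<in>L. s p k * t q k"
  let ?R = "block_pf a ?c (\<lambda>x y. - b x y)"
  show ?case
  proof (cases ps)
    case Nil
    \<comment> \<open>Without rows of \<open>a\<close>, the first factor is the Pfaffian of a zero
      matrix, which is nonzero only for empty \<open>K\<close>.\<close>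
    have "(\<Sum>K\<in>Pow L. ?P [] K * ?Q qs K) = (\<Sum>K\<in>{{}}. ?P [] K * ?Q qs K)"
    proof (rule sum.mono_neutral_right)
      show "\<forall>K\<in>Pow L - {{}}. ?P [] K * ?Q qs K = 0"
        using L by (auto simp: block_pf_Nil_left pf_zero simp del: list.map append.simps
            dest: finite_subset)
    qed (use L in auto)
    also have "\<dots> = pf b qs"
      by (simp add: block_pf_Nil_right[simplified])
    also have "\<dots> = (- 1) ^ (length qs choose 2) * ?R [] qs"
      unfolding block_pf_Nil_left pf_uminus by simp
    finally show ?thesis using Nil by simp
  next
    case (Cons p us)
    have "(\<Sum>K\<in>Pow L. ?P ps K * ?Q qs K) =
        (\<Sum>K\<in>Pow L. contract (a p) (\<lambda>zs. ?P zs K) us * ?Q qs K)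
        + (- 1) ^ length us * (\<Sum>K\<in>Pow L.
            contract (s p) (\<lambda>zs. block_pf a s (\<lambda>_ _. 0) us zs) (sorted_list_of_set K) * ?Q qs K)"
      unfolding Cons block_pf_Cons by (simp add: algebra_simps sum.distrib sum_distrib_left)
    also have "(\<Sum>K\<in>Pow L. contract (a p) (\<lambda>zs. ?P zs K) us * ?Q qs K)
        = contract (a p) (\<lambda>zs. \<Sum>K\<in>Pow L. ?P zs K * ?Q qs K) us"
      by (simp add: contract_sum_right contract_scale_right mult.commute[of _ "?Q qs _"])
    also have "\<dots> = contract (a p) (\<lambda>zs. (- 1) ^ (length qs choose 2) * ?R zs qs) us"
      by (rule contract_cong) (use 1 Cons in auto)
    also have "\<dots> = (- 1) ^ (length qs choose 2) * contract (a p) (\<lambda>zs. ?R zs qs) us"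
      by (rule contract_scale_right)
    also have "(\<Sum>K\<in>Pow L.
          contract (s p) (\<lambda>zs. block_pf a s (\<lambda>_ _. 0) us zs) (sorted_list_of_set K) * ?Q qs K)
        = - ((- 1) ^ length qs * contract (?c p) (\<lambda>zs. \<Sum>K\<in>Pow L. ?P us K * ?Q zs K) qs)"
      by (rule sum_contract_block_pf)
    also have "contract (?c p) (\<lambda>zs. \<Sum>K\<in>Pow L. ?P us K * ?Q zs K) qs
        = contract (?c p) (\<lambda>zs. (- 1) ^ ((length qs - 1) choose 2) * ?R us zs) qs"
    proof (rule contract_cong)
      show "(\<Sum>K\<in>Pow L. ?P us K * ?Q zs K) = (- 1) ^ ((length qs - 1) choose 2) * ?R us zs"
        if "Suc (length zs) = length qs" for zs
        using 1 Cons that[symmetric] by simp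
    qed auto
    also have "\<dots> = (- 1) ^ ((length qs - 1) choose 2) * contract (?c p) (\<lambda>zs. ?R us zs) qs"
      by (rule contract_scale_right)
    \<comment> \<open>For nonempty \<open>qs\<close>, \<open>length qs choose 2\<close> exceeds
      \<open>(length qs - 1) choose 2\<close> by \<open>length qs - 1\<close>, and the leading minus
      supplies the missing factor. For empty \<open>qs\<close> the contraction is 0.\<close>
    also have "- ((- 1) ^ length qs * \<dots>)
        = (- 1) ^ (length qs choose 2) * contract (?c p) (\<lambda>zs. ?R us zs) qs"
    proof (cases qs)
      case (Cons q zs)
      have "(- 1) ^ length qs * (- 1) ^ ((length qs - 1) choose 2)
          = - ((- 1) ^ (length qs choose 2) :: 'a)"
        by (simp add: Cons choose_two_Suc power_add mult.commute)
      then show ?thesis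
        by (simp only: mult.assoc[symmetric]) simp
    qed simp
    finally show ?thesis
      unfolding Cons block_pf_Cons by (simp only: distrib_left mult_ac)
  qed
qed

end

section \<open>Matching permutations and the expansion\<close>

lemma insert_index_less_iff: "insert_index j a < insert_index j b \<longleftrightarrow> a < b"
  by (auto simp: insert_index_def)

lemma nth_take_drop_Suc:
  assumes "j < length xs" "Suc i < length xs"
  shows "(take j xs @ drop (Suc j) xs) ! i = xs ! insert_index j i"
  using assms by (auto simp: nth_append insert_index_def min_def)

text \<open>The matching of \<open>0\<close> with \<open>Suc j\<close>, followed by \<open>\<tau>\<close> on the remaining points.\<close>

definition matching_insert :: "nat \<Rightarrow> (nat \<Rightarrow> nat) \<Rightarrow> nat \<Rightarrow> nat" where
  "matching_insert j \<tau> = permutation_insert 0 0 (permutation_insert 0 j \<tau>)"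

lemma matching_insert_simps [simp]:
  "matching_insert j \<tau> 0 = 0"
  "matching_insert j \<tau> (Suc 0) = Suc j"
  "matching_insert j \<tau> (Suc (Suc i)) = Suc (insert_index j (\<tau> i))"
  by (simp_all add: matching_insert_def permutation_insert_expand insert_index_def)

lemma matching_insert_permutes:
  assumes "\<tau> permutes {0..<n}" "j < Suc n"
  shows "matching_insert j \<tau> permutes {0..<Suc (Suc n)}"
  unfolding matching_insert_def using assms by (intro permutation_insert_permutes) auto

text \<open>Inserting the value \<open>j\<close> at position 0 costs \<open>(- 1) ^ j\<close>;
  inserting 0 at position 0 costs nothing. This is the sign in
  \<open>contract_conv_sum\<close>.\<close>

lemma signof_matching_insert:
  assumes "\<tau> permutes {0..<n}" "j < Suc n"
  shows "signof (matching_insert j \<tau>) = ((- 1) ^ j * signof \<tau> :: 'a :: ring_1)"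
  unfolding matching_insert_def
  using signof_permutation_insert[OF permutation_insert_permutes[OF assms(1) _ assms(2)], of 0 0 0,
      where 'a = 'a]
    signof_permutation_insert[OF assms(1) _ assms(2), of 0, where 'a = 'a]
  by simp

text \<open>The new first pair starts with the least value, so it satisfies its inequalities; on the
  other pairs \<open>insert_index j\<close> preserves order.\<close>

lemma matching_insert_mem:
  assumes "j < Suc (2 * r)" "\<tau> permutes {0..<2 * r}"
  shows "matching_insert j \<tau> \<in> matching_perms (Suc r) \<longleftrightarrow> \<tau> \<in> matching_perms r"
proof -
  have "matching_insert j \<tau> permutes {0..<2 * Suc r}"
    using matching_insert_permutes[OF assms(2,1)] by simp
  moreover have "(\<forall>i k. i < k \<and> k < Suc r \<longrightarrow> matching_insert j \<tau> (2 * i) < matching_insert j \<tau> (2 * k))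
      \<longleftrightarrow> (\<forall>i k. i < k \<and> k < r \<longrightarrow> \<tau> (2 * i) < \<tau> (2 * k))" (is "?L \<longleftrightarrow> ?R")
  proof
    assume L: ?L
    show ?R
    proof (intro allI impI)
      fix i k assume "i < k \<and> k < r"
      with L[rule_format, of "Suc i" "Suc k"] show "\<tau> (2 * i) < \<tau> (2 * k)"
        by (simp add: insert_index_less_iff)
    qed
  next
    assume R: ?R
    show ?L
    proof (intro allI impI)
      fix i k assume "i < k \<and> k < Suc r"
      with R show "matching_insert j \<tau> (2 * i) < matching_insert j \<tau> (2 * k)"
        by (cases i; cases k) (auto simp: insert_index_less_iff)
    qed
  qed
  moreover have "(\<forall>i<Suc r. matching_insert j \<tau> (2 * i) < matching_insert j \<tau> (2 * i + 1))
      \<longleftrightarrow> (\<forall>i<r. \<tau> (2 * i) < \<tau> (2 * i + 1))"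
    by (simp add: All_less_Suc2 insert_index_less_iff)
  ultimately show ?thesis using assms by (simp add: matching_perms_def)
qed

text \<open>The value 0 can neither be the second entry of a pair nor the first entry of a later
  pair.\<close>

lemma matching_perms_zero:
  assumes "\<sigma> \<in> matching_perms (Suc r)"
  shows "\<sigma> 0 = 0"
proof -
  have perm: "\<sigma> permutes {0..<2 * Suc r}"
    and rows: "\<And>i j. i < j \<Longrightarrow> j < Suc r \<Longrightarrow> \<sigma> (2 * i) < \<sigma> (2 * j)"
    and cols: "\<And>i. i < Suc r \<Longrightarrow> \<sigma> (2 * i) < \<sigma> (2 * i + 1)"
    using assms by (auto simp: matching_perms_def)
  have "0 \<in> \<sigma> ` {0..<2 * Suc r}"
    unfolding permutes_image[OF perm] by simp
  then obtain k where k: "k < 2 * Suc r" "\<sigma> k = 0"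
    by (metis atLeastLessThan_iff imageE)
  show ?thesis
  proof (cases "even k")
    case True
    then obtain i where i: "k = 2 * i" ..
    with k rows[of 0 i] show ?thesis by (cases "i = 0") auto
  next
    case False
    then obtain i where i: "k = 2 * i + 1" ..
    with k cols[of i] show ?thesis by simp
  qed
qed

lemma matching_insert_bij:
  "bij_betw (\<lambda>(j, \<tau>). matching_insert j \<tau>) ({..<Suc (2 * r)} \<times> matching_perms r)
     (matching_perms (Suc r))"
proof (rule bij_betw_imageI)
  show "inj_on (\<lambda>(j, \<tau>). matching_insert j \<tau>) ({..<Suc (2 * r)} \<times> matching_perms r)"
  proof (rule inj_onI, clarify)
    fix j j' \<tau> \<tau>'
    assume eq: "matching_insert j \<tau> = matching_insert j' \<tau>'"
    from fun_cong[OF eq, of "Suc 0"] have j: "j = j'" by simp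
    have "\<tau> i = \<tau>' i" for i
      using fun_cong[OF eq, of "Suc (Suc i)"] j
      by (metis delete_insert_index matching_insert_simps(3) nat.inject)
    with j show "j = j' \<and> \<tau> = \<tau>'" by auto
  qed
  show "(\<lambda>(j, \<tau>). matching_insert j \<tau>) ` ({..<Suc (2 * r)} \<times> matching_perms r)
      = matching_perms (Suc r)" (is "?f ` ?X = ?Y")
  proof
    show "?f ` ?X \<subseteq> ?Y"
      using matching_insert_mem by (fastforce simp: matching_perms_def)
    show "?Y \<subseteq> ?f ` ?X"
    proof
      fix \<sigma> assume \<sigma>: "\<sigma> \<in> ?Y"
      then have perm: "\<sigma> permutes {0..<Suc (Suc (2 * r))}"
        by (simp add: matching_perms_def)
      \<comment> \<open>Deleting position 0 twice inverts the insertion; the partner of 0 is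
        recovered from \<open>\<rho> 0\<close>.\<close>
      define \<rho> where "\<rho> = permutation_delete \<sigma> 0"
      define \<tau> where "\<tau> = permutation_delete \<rho> 0"
      have \<rho>: "\<rho> permutes {0..<Suc (2 * r)}"
        unfolding \<rho>_def by (rule permutation_delete_permutes[OF perm]) simp
      have \<tau>: "\<tau> permutes {0..<2 * r}"
        unfolding \<tau>_def by (rule permutation_delete_permutes[OF \<rho>]) simp
      have "\<sigma> = permutation_insert 0 0 \<rho>"
        using permutation_insert_delete[OF perm, of 0] matching_perms_zero[OF \<sigma>]
        by (simp add: \<rho>_def)
      also have "\<rho> = permutation_insert 0 (\<rho> 0) \<tau>"
        using permutation_insert_delete[OF \<rho>, of 0] by (simp add: \<tau>_def)
      finally have eq: "\<sigma> = matching_insert (\<rho> 0) \<tau>"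
        by (simp only: matching_insert_def)
      have "\<rho> 0 < Suc (2 * r)"
        using permutes_in_image[OF \<rho>, of 0] by simp
      with \<sigma> \<tau> have "(\<rho> 0, \<tau>) \<in> ?X"
        by (simp add: eq matching_insert_mem)
      with eq show "\<sigma> \<in> ?f ` ?X" by force
    qed
  qed
qed

lemma sum_matching_perms:
  assumes "length xs = 2 * r"
  shows "(\<Sum>\<sigma>\<in>matching_perms r. signof \<sigma> * (\<Prod>i<r. w (xs ! \<sigma> (2 * i)) (xs ! \<sigma> (2 * i + 1))))
    = pf w xs"
  using assms
proof (induction r arbitrary: xs)
  case 0
  then show ?case by (simp add: matching_perms_def)
next
  case (Suc r)
  then obtain x ys where xs: "xs = x # ys" and ys: "length ys = Suc (2 * r)"
    by (cases xs) auto
  let ?d = "\<lambda>j. take j ys @ drop (Suc j) ys"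
  let ?t = "\<lambda>r xs \<sigma>. signof \<sigma> * (\<Prod>i<r. w (xs ! \<sigma> (2 * i)) (xs ! \<sigma> (2 * i + 1)))"
  \<comment> \<open>The pair of 0 and \<open>Suc j\<close> contributes \<open>w x (ys ! j)\<close>;
    the other factors read the list with both entries removed.\<close>
  have step: "?t (Suc r) xs (matching_insert j \<tau>) = (- 1) ^ j * w x (ys ! j) * ?t r (?d j) \<tau>"
    if j: "j < Suc (2 * r)" and "\<tau> \<in> matching_perms r" for j \<tau>
  proof -
    have perm: "\<tau> permutes {0..<2 * r}"
      using that by (simp add: matching_perms_def)
    have nth: "?d j ! \<tau> i = ys ! insert_index j (\<tau> i)" if "i < 2 * r" for i
      using that j ys permutes_in_image[OF perm, of i] by (intro nth_take_drop_Suc) auto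
    have "(\<Prod>i<Suc r. w (xs ! matching_insert j \<tau> (2 * i)) (xs ! matching_insert j \<tau> (2 * i + 1)))
        = w x (ys ! j) * (\<Prod>i<r. w (?d j ! \<tau> (2 * i)) (?d j ! \<tau> (2 * i + 1)))"
    proof -
      have "(\<Prod>i<r. w (ys ! insert_index j (\<tau> (2 * i))) (ys ! insert_index j (\<tau> (2 * i + 1))))
          = (\<Prod>i<r. w (?d j ! \<tau> (2 * i)) (?d j ! \<tau> (2 * i + 1)))"
        by (rule prod.cong) (auto simp only: nth lessThan_iff intro!: arg_cong2[where f = w] nth[symmetric])
      then show ?thesis
        by (simp add: prod.lessThan_Suc_shift xs del: prod.lessThan_Suc)
    qed
    then show ?thesis
      by (simp only: signof_matching_insert[OF perm j] mult_ac)
  qed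
  have "(\<Sum>\<sigma>\<in>matching_perms (Suc r). ?t (Suc r) xs \<sigma>)
      = (\<Sum>(j, \<tau>)\<in>{..<Suc (2 * r)} \<times> matching_perms r. ?t (Suc r) xs (matching_insert j \<tau>))"
    by (subst sum.reindex_bij_betw[OF matching_insert_bij, symmetric]) (simp only: split_def)
  also have "\<dots> = (\<Sum>(j, \<tau>)\<in>{..<Suc (2 * r)} \<times> matching_perms r.
      (- 1) ^ j * w x (ys ! j) * ?t r (?d j) \<tau>)"
  proof (rule sum.cong[OF refl], clarify)
    fix j \<tau> assume "j < Suc (2 * r)" "\<tau> \<in> matching_perms r"
    then show "?t (Suc r) xs (matching_insert j \<tau>) = (- 1) ^ j * w x (ys ! j) * ?t r (?d j) \<tau>"
      by (rule step)
  qed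
  also have "\<dots> = (\<Sum>j<Suc (2 * r). (- 1) ^ j * w x (ys ! j) *
      (\<Sum>\<tau>\<in>matching_perms r. ?t r (?d j) \<tau>))"
    by (simp only: sum.cartesian_product[symmetric] sum_distrib_left)
  also have "\<dots> = (\<Sum>j<Suc (2 * r). (- 1) ^ j * w x (ys ! j) * pf w (?d j))"
    by (intro sum.cong refl arg_cong2[where f = "(*)"] Suc.IH) (use ys in auto)
  also have "\<dots> = pf w xs"
    by (simp only: xs pf.simps contract_conv_sum ys)
  finally show ?case .
qed

section \<open>From matrices to lists\<close>

lemma pfaffian_conv_pf:
  assumes "even (dim_row X)"
  shows "pfaffian X = pf (\<lambda>i j. X $$ (i, j)) [0..<dim_row X]"
proof -
  define r where "r = dim_row X div 2"
  have r: "dim_row X = 2 * r" using assms by (simp add: r_def)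
  have "pfaffian X = (\<Sum>\<sigma>\<in>matching_perms r. signof \<sigma> *
      (\<Prod>i<r. X $$ ([0..<2 * r] ! \<sigma> (2 * i), [0..<2 * r] ! \<sigma> (2 * i + 1))))"
    unfolding pfaffian_def Let_def r_def[symmetric]
  proof (intro sum.cong refl arg_cong2[where f = "(*)"] prod.cong)
    fix \<sigma> i assume "\<sigma> \<in> matching_perms r" "i \<in> {..<r}"
    then have "\<sigma> permutes {0..<2 * r}" "2 * i + 1 \<in> {0..<2 * r}" "2 * i \<in> {0..<2 * r}"
      by (auto simp: matching_perms_def)
    then have "\<sigma> (2 * i) < 2 * r" "\<sigma> (2 * i + 1) < 2 * r"
      by (metis permutes_in_image atLeastLessThan_iff)+
    then show "X $$ (\<sigma> (2 * i), \<sigma> (2 * i + 1))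
        = X $$ ([0..<2 * r] ! \<sigma> (2 * i), [0..<2 * r] ! \<sigma> (2 * i + 1))"
      by simp
  qed
  also have "\<dots> = pf (\<lambda>i j. X $$ (i, j)) [0..<2 * r]"
    by (rule sum_matching_perms) simp
  finally show ?thesis by (simp only: r)
qed

lemma sorted_list_of_set_conv_pick:
  assumes "finite K"
  shows "sorted_list_of_set K = map (pick K) [0..<card K]"
proof (rule sorted_list_of_set_unique[THEN iffD1, OF assms])
  have sorted: "sorted_wrt (<) (map (pick K) [0..<card K])"
    by (auto simp: sorted_wrt_iff_nth_less intro: pick_mono_le)
  moreover have "set (map (pick K) [0..<card K]) = K"
  proof (rule card_subset_eq[OF assms])
    show "set (map (pick K) [0..<card K]) \<subseteq> K"
      by (auto intro: pick_in_set_le)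
    show "card (set (map (pick K) [0..<card K])) = card K"
      using distinct_card[of "map (pick K) [0..<card K]"] sorted
      by (simp add: strict_sorted_iff)
  qed
  ultimately show "sorted_wrt (<) (map (pick K) [0..<card K])
      \<and> set (map (pick K) [0..<card K]) = K
      \<and> length (map (pick K) [0..<card K]) = card K"
    by simp
qed

text \<open>Entries are compared within range only, so \<open>a\<close>, \<open>s\<close> and
  \<open>d\<close> may be chosen freely elsewhere. The list \<open>ks\<close> lets the columns keep
  their original names.\<close>

lemma pfaffian_four_block_mat:
  assumes "A \<in> carrier_mat m m" "C \<in> carrier_mat m k" "D \<in> carrier_mat k k"
    and "even (m + k)" "length ks = k"
    and a: "\<And>i j. i < m \<Longrightarrow> j < m \<Longrightarrow> A $$ (i, j) = a i j"
    and s: "\<And>i j. i < m \<Longrightarrow> j < k \<Longrightarrow> C $$ (i, j) = s i (ks ! j)"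
    and d: "\<And>i j. i < k \<Longrightarrow> j < k \<Longrightarrow> D $$ (i, j) = d (ks ! i) (ks ! j)"
  shows "pfaffian (four_block_mat A C (- transpose_mat C) D) = block_pf a s d [0..<m] ks"
proof -
  define h where "h i = (if i < m then Inl i else Inr (ks ! (i - m)))" for i
  have "map h [0..<m + k] = map Inl [0..<m] @ map Inr ks"
    by (rule nth_equalityI) (use assms(5) in \<open>auto simp: h_def nth_append\<close>)
  then have "block_pf a s d [0..<m] ks = pf (\<lambda>i j. block_weight a s d (h i) (h j)) [0..<m + k]"
    by (metis pf_map)
  also have "\<dots> = pf (\<lambda>i j. four_block_mat A C (- transpose_mat C) D $$ (i, j)) [0..<m + k]"
    by (rule pf_cong) (use assms(1-3) in \<open>auto simp: h_def a s d\<close>)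
  also have "\<dots> = pfaffian (four_block_mat A C (- transpose_mat C) D)"
    using assms(1,3,4) by (subst pfaffian_conv_pf) auto
  finally show ?thesis ..
qed

theorem theorem1p1:
  fixes m n l :: nat
    and A B S T :: "'a :: comm_ring_1 mat"
  assumes "m mod 2 = n mod 2"
    and "A \<in> carrier_mat m m" and "skew_symmetric_mat A"
    and "B \<in> carrier_mat n n" and "skew_symmetric_mat B"
    and "S \<in> carrier_mat m l" and "T \<in> carrier_mat n l"
  shows "(\<Sum>K \<in> {K. K \<subseteq> {0..<l} \<and> card K mod 2 = m mod 2 \<and> card K mod 2 = n mod 2}.
            pfaffian (four_block_mat A (submatrix S {0..<m} K)
                        (- transpose_mat (submatrix S {0..<m} K)) (0\<^sub>m (card K) (card K)))
          * pfaffian (four_block_mat B (submatrix T {0..<n} K)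
                        (- transpose_mat (submatrix T {0..<n} K)) (0\<^sub>m (card K) (card K))))
         = (- 1) ^ (n choose 2)
           * pfaffian (four_block_mat A (S * transpose_mat T)
                         (- (T * transpose_mat S)) (- B))"
proof -
  \<comment> \<open>extended by \<open>0\<close>, because entries of \<open>B\<close> outside its range need not be alternating\<close>
  define b where "b i j = (if i < n \<and> j < n then B $$ (i, j) else 0)" for i j
  let ?a = "\<lambda>i j. A $$ (i, j)" and ?s = "\<lambda>i j. S $$ (i, j)" and ?t = "\<lambda>i j. T $$ (i, j)"
  let ?X = "\<lambda>K. block_pf ?a ?s (\<lambda>_ _. 0) [0..<m] (sorted_list_of_set K)"
  let ?Y = "\<lambda>K. block_pf b ?t (\<lambda>_ _. 0) [0..<n] (sorted_list_of_set K)"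
  have B: "B $$ (j, i) = - B $$ (i, j)" "B $$ (i, i) = 0" if "i < n" "j < n" for i j
  proof -
    have "transpose_mat B $$ (i, j) = (- B) $$ (i, j)"
      using assms(5) by (simp add: skew_symmetric_mat_def)
    then show "B $$ (j, i) = - B $$ (i, j)"
      using that assms(4) by simp
    show "B $$ (i, i) = 0"
      using that assms(4,5) by (auto simp: skew_symmetric_mat_def)
  qed
  have even: "even (m + n)" using assms(1) by presburger
  have b: "alternating_weight b"
  proof
    show "b y x = - b x y" for x y using B(1)[of x y] by (simp add: b_def)
    show "b x x = 0" for x using B(2)[of x x] by (simp add: b_def)
  qed
  \<comment> \<open>\<open>submatrix\<close> selects through \<open>pick\<close>, which is the
    identity on the full row range and enumerates \<open>K\<close> in increasing order.\<close>
  have sub: "submatrix M {0..<p} K \<in> carrier_mat p (card K)"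
    "\<And>i j. i < p \<Longrightarrow> j < card K \<Longrightarrow>
      submatrix M {0..<p} K $$ (i, j) = M $$ (i, sorted_list_of_set K ! j)"
    if M: "M \<in> carrier_mat p l" and K: "K \<subseteq> {0..<l}" for M :: "'a mat" and p K
  proof -
    have rows: "{i. i < dim_row M \<and> i \<in> {0..<p}} = {0..<p}"
      and cols: "{j. j < dim_col M \<and> j \<in> K} = K"
      using M K by auto
    have pick: "pick {0..<p} i = i" if "i < p" for i
    proof -
      have "sorted_list_of_set {0..<p} ! i = pick {0..<p} i"
        using that by (subst sorted_list_of_set_conv_pick) auto
      with that show ?thesis by simp
    qed
    have fin: "finite K" using K finite_subset by blast
    show "submatrix M {0..<p} K \<in> carrier_mat p (card K)"
      by (rule carrier_matI) (simp_all add: dim_submatrix rows cols del: atLeastLessThan_iff)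
    show "submatrix M {0..<p} K $$ (i, j) = M $$ (i, sorted_list_of_set K ! j)"
      if "i < p" "j < card K" for i j
      unfolding submatrix_def rows cols using that fin
      by (simp add: pick sorted_list_of_set_conv_pick)
  qed
  have "(\<Sum>K \<in> {K. K \<subseteq> {0..<l} \<and> card K mod 2 = m mod 2 \<and> card K mod 2 = n mod 2}.
            pfaffian (four_block_mat A (submatrix S {0..<m} K)
                        (- transpose_mat (submatrix S {0..<m} K)) (0\<^sub>m (card K) (card K)))
          * pfaffian (four_block_mat B (submatrix T {0..<n} K)
                        (- transpose_mat (submatrix T {0..<n} K)) (0\<^sub>m (card K) (card K))))
      = (\<Sum>K \<in> {K. K \<subseteq> {0..<l} \<and> card K mod 2 = m mod 2 \<and> card K mod 2 = n mod 2}. ?X K * ?Y K)"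
  proof (rule sum.cong[OF refl])
    fix K assume "K \<in> {K. K \<subseteq> {0..<l} \<and> card K mod 2 = m mod 2 \<and> card K mod 2 = n mod 2}"
    then have K: "K \<subseteq> {0..<l}" and "card K mod 2 = m mod 2" "card K mod 2 = n mod 2"
      by auto
    then have "even (m + card K)" "even (n + card K)" by presburger+
    moreover have "finite K" using K finite_subset by blast
    ultimately show "pfaffian (four_block_mat A (submatrix S {0..<m} K)
                        (- transpose_mat (submatrix S {0..<m} K)) (0\<^sub>m (card K) (card K)))
          * pfaffian (four_block_mat B (submatrix T {0..<n} K)
                        (- transpose_mat (submatrix T {0..<n} K)) (0\<^sub>m (card K) (card K)))
        = ?X K * ?Y K"
      using assms(2,4)
      by (intro arg_cong2[where f = "(*)"] pfaffian_four_block_mat[where k = "card K"]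
          sub[OF assms(6) K] sub[OF assms(7) K]) (auto simp: b_def)
  qed
  \<comment> \<open>For \<open>K\<close> of the other parity the first factor is a Pfaffian of odd
    order, hence 0.\<close>
  also have "\<dots> = (\<Sum>K\<in>Pow {0..<l}. ?X K * ?Y K)"
  proof (rule sum.mono_neutral_left)
    show "\<forall>K\<in>Pow {0..<l} - {K. K \<subseteq> {0..<l} \<and> card K mod 2 = m mod 2 \<and> card K mod 2 = n mod 2}.
        ?X K * ?Y K = 0"
    proof
      fix K assume "K \<in> Pow {0..<l} - {K. K \<subseteq> {0..<l} \<and> card K mod 2 = m mod 2 \<and> card K mod 2 = n mod 2}"
      then have "finite K" "card K mod 2 \<noteq> m mod 2"
        using assms(1) by (auto dest: finite_subset)
      then have "odd (m + card K)" by presburger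
      then have "?X K = 0" by (intro pf_odd) simp
      then show "?X K * ?Y K = 0" by simp
    qed
  qed auto
  also have "\<dots> = (- 1) ^ (n choose 2)
      * block_pf ?a (\<lambda>p q. \<Sum>k\<in>{0..<l}. S $$ (p, k) * T $$ (q, k)) (\<lambda>x y. - b x y) [0..<m] [0..<n]"
    by (subst sum_block_pf[OF _ b]) simp_all
  also have "block_pf ?a (\<lambda>p q. \<Sum>k\<in>{0..<l}. S $$ (p, k) * T $$ (q, k)) (\<lambda>x y. - b x y) [0..<m] [0..<n]
      = pfaffian (four_block_mat A (S * transpose_mat T) (- transpose_mat (S * transpose_mat T)) (- B))"
    by (rule pfaffian_four_block_mat[where k = n, symmetric])
      (use assms(2,4,6,7) even in \<open>auto simp: b_def scalar_prod_def\<close>)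
  also have "transpose_mat (S * transpose_mat T) = T * transpose_mat S"
    using assms(6,7) by (simp add: transpose_mult)
  finally show ?thesis .
qed

end
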